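(* Every proper bracket is dramatic.
   Context: A bracket on $n\ge1$ teams is a full binary tree (children unordered) whose $n$ leaves are labelled bijectively by the seeds $1,\dots,n$. Team $t_i$ (the $i$-seed) begins at the leaf labelled $i$. Each internal node is a game between the teams arriving from its two children; the winner moves up and the loser plays no more games (is eliminated); the team reaching the root is the champion. If the tree has height $r$, there are $r$ rounds: the games at distance $d$ from the root form round $r-d$. A team has a bye in round $s$ if it plays no game in round $s$ or before. Smaller numbers are higher seeds. A bracket goes chalk if the higher-seeded team (smaller number) wins every game. A bracket is proper if, when it goes chalk, in every round it is better to be a higher-seeded than a lower-seeded team, where (a) it is better to have a bye than to play a game, and (b) it is better to play a lower seed than a higher seed. Explicitly: for every round $s$ and all $i<j$ such that $t_i$ and $t_j$ have not lost before round $s$ when the bracket goes chalk: if $t_j$ has a bye in round $s$ then so does $t_i$; and if both play in round $s$, then the opponent of $t_i$ has a larger seed number than the opponent of $t_j$. A bracket is dramatic if, as long as the bracket goes chalk, in every round, the $m$ remaining (not yet eliminated) teams are the top $m$ seeds, i.e. seeds $1,\dots,m$. *)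

theory Defs
  imports Main
begin

text \<open>
  The children of a game are unordered: \<open>Game l r\<close> and \<open>Game r l\<close> represent the same bracket,
  and none of the notions below distinguishes them.
\<close>

datatype bracket = Team nat | Game bracket bracket

fun seeds :: "bracket \<Rightarrow> nat list" where
  "seeds (Team i) = [i]"
| "seeds (Game l r) = seeds l @ seeds r"

definition bracket_on :: "nat \<Rightarrow> bracket \<Rightarrow> bool" where
  "bracket_on n b \<longleftrightarrow> distinct (seeds b) \<and> set (seeds b) = {1..n}"

fun height :: "bracket \<Rightarrow> nat" where
  "height (Team i) = 0"
| "height (Game l r) = Suc (max (height l) (height r))"

text \<open>The subtrees whose root is at distance \<open>d\<close> from the root of the bracket.\<close>

fun subtrees_at :: "nat \<Rightarrow> bracket \<Rightarrow> bracket set" where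
  "subtrees_at 0 b = {b}"
| "subtrees_at (Suc d) (Team i) = {}"
| "subtrees_at (Suc d) (Game l r) = subtrees_at d l \<union> subtrees_at d r"

text \<open>
  From here on the bracket is assumed to go chalk. \<open>chalk_winner b\<close> is the team that
  emerges from the root of \<open>b\<close>.
\<close>

fun chalk_winner :: "bracket \<Rightarrow> nat" where
  "chalk_winner (Team i) = i"
| "chalk_winner (Game l r) = min (chalk_winner l) (chalk_winner r)"

text \<open>
  \<open>plays b s i j\<close>: teams \<open>i\<close> and \<open>j\<close> meet in round \<open>s\<close>. The games at distance \<open>d\<close> from the root
  form round \<open>height b - d\<close>, stated additively to avoid truncated subtraction.
\<close>

definition plays :: "bracket \<Rightarrow> nat \<Rightarrow> nat \<Rightarrow> nat \<Rightarrow> bool" where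
  "plays b s i j \<longleftrightarrow>
     (\<exists>d l r. d + s = height b \<and> Game l r \<in> subtrees_at d b \<and>
       (i = chalk_winner l \<and> j = chalk_winner r \<or> i = chalk_winner r \<and> j = chalk_winner l))"

text \<open>The teams that have not lost before round \<open>s\<close>; a team loses exactly to smaller seeds.\<close>

definition remaining :: "bracket \<Rightarrow> nat \<Rightarrow> nat set" where
  "remaining b s = {i \<in> set (seeds b). \<not> (\<exists>s'<s. \<exists>j<i. plays b s' i j)}"

text \<open>
  Whether a team has a bye does not depend on the outcomes of games, since its first game is
  the parent of its leaf whoever wins elsewhere.
\<close>

definition has_bye :: "bracket \<Rightarrow> nat \<Rightarrow> nat \<Rightarrow> bool" where
  "has_bye b s i \<longleftrightarrow> \<not> (\<exists>s'\<le>s. \<exists>j. plays b s' i j)"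

definition proper :: "bracket \<Rightarrow> bool" where
  "proper b \<longleftrightarrow>
     (\<forall>s \<in> {1..height b}. \<forall>i \<in> remaining b s. \<forall>j \<in> remaining b s. i < j \<longrightarrow>
        (has_bye b s j \<longrightarrow> has_bye b s i) \<and>
        (\<forall>i' j'. plays b s i i' \<and> plays b s j j' \<longrightarrow> i' > j'))"

definition dramatic :: "bracket \<Rightarrow> bool" where
  "dramatic b \<longleftrightarrow> (\<forall>s \<in> {1..height b}. \<exists>m. remaining b s = {1..m})"

end

theory Submission
  imports Defs
begin

text \<open>
  By induction on \<open>s\<close>, the teams remaining before round \<open>s\<close> are closed under passing to higher
  seeds. For the step, let \<open>i < j\<close> both remain before round \<open>s\<close> and suppose that \<open>i\<close> loses to
  \<open>i' < i\<close> in round \<open>s\<close>. As \<open>i\<close> has no bye, neither has \<open>j\<close>, and a remaining team without a bye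
  plays in round \<open>s\<close>; its opponent \<open>j'\<close> satisfies \<open>j' < i' < i < j\<close>, so \<open>j\<close> loses too.
\<close>

lemma subtrees_at_height: "t \<in> subtrees_at d b \<Longrightarrow> d + height t \<le> height b"
  by (induction d b rule: subtrees_at.induct) auto

text \<open>\<open>subtrees_at\<close> descends from the root, but the parent sits at the far end of
  the path; so induct along the path, passing to the child of the root that contains
  \<open>t\<close>.\<close>

lemma subtrees_at_parent:
  "t \<in> subtrees_at (Suc d) b \<Longrightarrow>
    \<exists>u. Game t u \<in> subtrees_at d b \<or> Game u t \<in> subtrees_at d b"
proof (induction d arbitrary: b)
  case 0
  then show ?case by (cases b) auto
next
  case (Suc d)
  show ?case
  proof (cases b)
    case (Team i)
    then show ?thesis using Suc.prems by simp
  next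
    case (Game l r)
    then have "t \<in> subtrees_at (Suc d) l \<or> t \<in> subtrees_at (Suc d) r"
      using Suc.prems by simp
    then obtain u where
      "Game t u \<in> subtrees_at d l \<union> subtrees_at d r \<or> Game u t \<in> subtrees_at d l \<union> subtrees_at d r"
      using Suc.IH by blast
    then show ?thesis using Game by auto
  qed
qed

text \<open>A game has positive height, so none lies at distance \<open>height b\<close> from the
  root.\<close>

lemma not_plays_0: "\<not> plays b 0 i j"
  unfolding plays_def by (auto dest: subtrees_at_height)

lemma remaining_1: "remaining b 1 = set (seeds b)"
  by (auto simp: remaining_def not_plays_0)

lemma remaining_Suc: "remaining b (Suc s) = {i \<in> remaining b s. \<not> (\<exists>j<i. plays b s i j)}"
  by (auto simp: remaining_def less_Suc_eq)

text \<open>The winner \<open>i\<close> emerges from a game that, by \<open>s < height b\<close>, is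
  not the root, and meets the winner of the sibling subtree one level up.\<close>

lemma plays_Suc:
  assumes "plays b s i j" "i \<le> j" "s < height b"
  shows "\<exists>k. plays b (Suc s) i k"
proof -
  obtain d l r where d: "d + s = height b" and game: "Game l r \<in> subtrees_at d b"
    and ij: "i = chalk_winner l \<and> j = chalk_winner r \<or> i = chalk_winner r \<and> j = chalk_winner l"
    using assms(1) unfolding plays_def by blast
  have winner: "chalk_winner (Game l r) = i" using ij assms(2) by auto
  obtain d' where d': "d = Suc d'" using d assms(3) by (cases d) auto
  obtain u where
    "Game (Game l r) u \<in> subtrees_at d' b \<or> Game u (Game l r) \<in> subtrees_at d' b"
    using subtrees_at_parent game d' by blast
  moreover have "d' + Suc s = height b" using d d' by simp
  ultimately show ?thesis using winner unfolding plays_def by metis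
qed

lemma remaining_plays_if_no_bye:
  assumes "i \<in> remaining b s" "\<not> has_bye b s i" "s \<le> height b"
  shows "\<exists>j. plays b s i j"
proof -
  obtain s' where s': "s' \<le> s" "\<exists>j. plays b s' i j"
    using assms(2) unfolding has_bye_def by blast
  from s' show ?thesis
  \<comment> \<open>With \<open>s\<close> fixed, the starting round moves down from
    \<open>s\<close>: a game of \<open>i\<close> in round \<open>k\<close> forces one in round
    \<open>Suc k\<close>, hence in round \<open>s\<close>.\<close>
  proof (induction rule: inc_induct)
    case (step k)
    then obtain j where j: "plays b k i j" by blast
    \<comment> \<open>Otherwise \<open>i\<close> would have lost in round \<open>k\<close>, before
      round \<open>s\<close>.\<close>
    have "i \<le> j" using assms(1) j \<open>k < s\<close> unfolding remaining_def by (auto simp: not_less[symmetric])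
    then show ?case using plays_Suc j step assms(3) by simp
  qed
qed

lemma proper_remaining_downward_closed:
  assumes "bracket_on n b" "proper b" "1 \<le> s" "s \<le> height b"
    and "j \<in> remaining b s" "1 \<le> i" "i < j"
  shows "i \<in> remaining b s"
  using assms(3-)
proof (induction s arbitrary: i j rule: nat_induct_at_least)
  case base
  \<comment> \<open>Before the first round all of \<open>{1..n}\<close> remain.\<close>
  then show ?case using assms(1) by (auto simp: remaining_1[simplified] bracket_on_def)
next
  case (Suc s)
  have j: "j \<in> remaining b s" using Suc.prems(2) by (simp add: remaining_Suc)
  then have i: "i \<in> remaining b s" using Suc.IH Suc.prems by simp
  show ?case
  proof (rule ccontr)
    assume "i \<notin> remaining b (Suc s)"
    then obtain i' where i': "i' < i" "plays b s i i'" using i by (auto simp: remaining_Suc)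
    have s: "s \<in> {1..height b}" using Suc by simp
    have "\<not> has_bye b s i" using i' unfolding has_bye_def by blast
    then have no_bye: "\<not> has_bye b s j" using assms(2) s i j \<open>i < j\<close> unfolding proper_def by blast
    then obtain j' where j': "plays b s j j'"
      using remaining_plays_if_no_bye[OF j no_bye] s by auto
    then have "j' < i'" using assms(2) s i j \<open>i < j\<close> i' unfolding proper_def by blast
    then have "j' < j" using i' \<open>i < j\<close> by simp
    then show False using j' Suc.prems(2) by (auto simp: remaining_Suc)
  qed
qed

lemma downward_closed_eq_atLeastAtMost:
  fixes A :: "nat set"
  assumes "finite A" "0 \<notin> A" and "\<And>i j. j \<in> A \<Longrightarrow> 1 \<le> i \<Longrightarrow> i < j \<Longrightarrow> i \<in> A"
  shows "\<exists>m. A = {1..m}"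
proof (cases "A = {}")
  case True
  then have "A = {1..0}" by simp
  then show ?thesis by blast
next
  case False
  \<comment> \<open>Closure fills in everything from 1 up to the maximum.\<close>
  have "A = {1..Max A}"
  proof
    show "A \<subseteq> {1..Max A}" using assms(1,2) by (auto simp: Suc_le_eq intro: gr0I)
    show "{1..Max A} \<subseteq> A"
      using assms(3)[OF Max_in[OF assms(1) False]] Max_in[OF assms(1) False]
      by (auto simp: le_less)
  qed
  then show ?thesis by blast
qed

theorem lemma2p2p11:
  fixes n :: nat and b :: bracket
  assumes "bracket_on n b"
    and "proper b"
  shows "dramatic b"
  unfolding dramatic_def
proof
  fix s assume s: "s \<in> {1..height b}"
  have "remaining b s \<subseteq> {1..n}" using assms(1) by (auto simp: remaining_def bracket_on_def)
  then have "finite (remaining b s)" "0 \<notin> remaining b s"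
    using finite_subset by auto
  then show "\<exists>m. remaining b s = {1..m}"
    using downward_closed_eq_atLeastAtMost proper_remaining_downward_closed[OF assms] s by auto
qed

end
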